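(* Let $G$ be a finite connected amply regular graph with parameters $(n,d,\alpha,\beta)$, which is neither complete nor empty, and let $\theta_1\le\cdots\le\theta_{n-1}\le\theta_n=d$ be the eigenvalues (with multiplicity) of its adjacency matrix. (i) If $1\ne\beta\ge\alpha$ and $(\alpha,\beta)\ne(2,2)$, then $$\theta_{n-1}\le d-2-\max\left\{\frac{\alpha}{2},\left\lceil\frac{(\beta-\alpha)\alpha}{\beta-1}\right\rceil\right\}.$$ (ii) If $\alpha=\beta=2$, then $\theta_{n-1}\le d-2$.
   Context: All graphs are simple and undirected. An amply regular graph with parameters $(n,d,\alpha,\beta)$ is a $d$-regular graph with $n$ vertices such that any two adjacent vertices have exactly $\alpha$ common neighbors and any two vertices at distance $2$ have exactly $\beta$ common neighbors. *)

theory Defs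
  imports
    "Graph_Theory.Shortest_Path"
    "Graph_Theory.Kuratowski"
    "Jordan_Normal_Form.Char_Poly"
begin

definition common_neighbors :: "('a, 'b) pre_digraph \<Rightarrow> 'a \<Rightarrow> 'a \<Rightarrow> 'a set" where
  "common_neighbors G u v = {w \<in> verts G. u \<rightarrow>\<^bsub>G\<^esub> w \<and> v \<rightarrow>\<^bsub>G\<^esub> w}"

text \<open>
  The locale \<^locale>\<open>graph\<close> models finite simple undirected graphs: an edge is a pair of
  opposite arcs, so the out-degree of a vertex is its degree. The graph distance is \<open>\<mu>\<close>
  with every arc having weight 1.
\<close>

locale amply_regular_graph = graph G
  for G :: "('a, 'b) pre_digraph" (structure) +
  fixes n d \<alpha> \<beta> :: nat
  assumes card_verts: "card (verts G) = n"
    and regular: "\<And>v. v \<in> verts G \<Longrightarrow> out_degree G v = d"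
    and adjacent: "\<And>u v. u \<in> verts G \<Longrightarrow> v \<in> verts G \<Longrightarrow> u \<rightarrow> v \<Longrightarrow>
      card (common_neighbors G u v) = \<alpha>"
    and distance_two: "\<And>u v. u \<in> verts G \<Longrightarrow> v \<in> verts G \<Longrightarrow> \<mu> (\<lambda>_. 1) u v = 2 \<Longrightarrow>
      card (common_neighbors G u v) = \<beta>"

text \<open>
  The rows and columns are indexed through an enumeration \<open>vs\<close> of the vertices, intended to
  satisfy \<open>distinct vs\<close> and \<open>set vs = verts G\<close>.
\<close>

definition adjacency_matrix :: "('a, 'b) pre_digraph \<Rightarrow> 'a list \<Rightarrow> real mat" where
  "adjacency_matrix G vs =
    mat (length vs) (length vs) (\<lambda>(i, j). if vs ! i \<rightarrow>\<^bsub>G\<^esub> vs ! j then 1 else 0)"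

end

theory Submission
  imports Defs
begin

text \<open>
  The quotient of the adjacency operator by the constants has the eigenvalues
  \<open>\<theta>\<^sub>1, \<dots>, \<theta>\<^sub>n\<^sub>-\<^sub>1\<close>, so each of these has a nonconstant \<open>F\<close> with \<open>A F = \<mu> F + c\<close>. Two discrete
  curvature bounds then apply to \<open>F\<close>.

  The Lin--Lu--Yau curvature gives the ceiling. For an edge \<open>x y\<close>, give the pairs in
  \<open>(N x - {y}) \<times> (N y - {x})\<close> weight 1 if they are adjacent and weight \<open>\<beta> - \<alpha>\<close> if they are equal. This
  bipartite multigraph is \<open>(\<beta> - 1)\<close>-regular, so some perfect matching contains at least the average
  \<open>(\<beta> - \<alpha>) \<alpha> / (\<beta> - 1)\<close> of pairs \<open>z = z\<close>. Transporting along this matching at an edge where the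
  difference of \<open>F\<close> is maximal bounds \<open>\<mu>\<close>.

  The Bakry--Emery curvature gives \<open>\<alpha> / 2\<close>: the inequality \<open>\<Gamma>\<^sub>2 \<ge> (2 + \<alpha>/2) \<Gamma>\<close> reduces at each vertex to
  \<open>(\<beta> - 2) d \<ge> 2 \<mu>' (\<alpha> - \<mu>')\<close> for the eigenvalues \<open>\<mu>'\<close> of the local graph, which holds as soon as
  \<open>\<alpha>\<^sup>2 \<le> 2 (\<beta> - 2) d\<close>. This fails only for \<open>\<beta> = 2\<close> and \<open>\<alpha> \<in> {1, 2}\<close>; for \<open>\<alpha> = 1\<close> the first bound suffices.
\<close>

section \<open>Perfect matchings in regular bipartite multigraphs\<close>

text \<open>Halmos-Vaughan induction on \<open>card I\<close>: if some proper nonempty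
  \<open>J\<close> attains equality, then \<open>J\<close> and \<open>I - J\<close> are matched
  separately; otherwise the slack in every such subset leaves room to fix one pair
  arbitrarily.\<close>

theorem hall_marriage:
  fixes A :: "'a \<Rightarrow> 'b set"
  assumes "finite I" and "\<And>i. i \<in> I \<Longrightarrow> finite (A i)"
    and "\<And>J. J \<subseteq> I \<Longrightarrow> card J \<le> card (\<Union> (A ` J))"
  shows "\<exists>f. inj_on f I \<and> (\<forall>i\<in>I. f i \<in> A i)"
  using assms
proof (induction "card I" arbitrary: I A rule: less_induct)
  case less
  note fin = less.prems(1) and finA = less.prems(2) and hall = less.prems(3)
  have finU: "finite (\<Union> (A ` J))" if "J \<subseteq> I" for J
    using that fin finA by (meson finite_UN_I finite_subset subsetD)
  show ?case
  proof (cases "\<exists>J. J \<subset> I \<and> J \<noteq> {} \<and> card (\<Union> (A ` J)) = card J")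
    case True
    then obtain J where J: "J \<subset> I" "J \<noteq> {}" "card (\<Union> (A ` J)) = card J"
      by blast
    have finJ: "finite J"
      using J(1) fin finite_subset by blast
    have cJ: "card J < card I"
      using J(1) fin psubset_card_mono by blast
    have "\<exists>f. inj_on f J \<and> (\<forall>i\<in>J. f i \<in> A i)"
      using J(1) finA hall by (intro less.hyps[OF cJ finJ]) auto
    then obtain f where f: "inj_on f J" "\<forall>i\<in>J. f i \<in> A i"
      by blast
    \<comment> \<open>Since \<open>J\<close> is tight, deleting everything its members can reach
      costs exactly \<open>card J\<close>, so Hall's condition survives on
      \<open>I - J\<close>.\<close>
    define B where "B i = A i - \<Union> (A ` J)" for i
    have cIJ: "card (I - J) < card I"
      using J fin by (intro psubset_card_mono) auto
    have "\<exists>g. inj_on g (I - J) \<and> (\<forall>i\<in>I - J. g i \<in> B i)"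
    proof (rule less.hyps[OF cIJ])
      fix K assume K: "K \<subseteq> I - J"
      have finK: "finite K"
        using K fin by (meson finite_Diff finite_subset)
      have sub: "K \<union> J \<subseteq> I"
        using K J(1) by blast
      have "card K + card J = card (K \<union> J)"
        using K finK finJ by (subst card_Un_disjoint) auto
      also have "\<dots> \<le> card (\<Union> (A ` (K \<union> J)))"
        using hall[OF sub] .
      also have "\<Union> (A ` (K \<union> J)) = \<Union> (B ` K) \<union> \<Union> (A ` J)"
        unfolding B_def by blast
      also have "card \<dots> \<le> card (\<Union> (B ` K)) + card (\<Union> (A ` J))"
        by (rule card_Un_le)
      finally show "card K \<le> card (\<Union> (B ` K))"
        using J(3) by simp
    qed (use fin finA in \<open>auto simp: B_def\<close>)
    then obtain g where g: "inj_on g (I - J)" "\<forall>i\<in>I - J. g i \<in> B i"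
      by blast
    define h where "h i = (if i \<in> J then f i else g i)" for i
    have "inj_on h I"
    proof (rule inj_onI)
      fix i j assume ij: "i \<in> I" "j \<in> I" "h i = h j"
      have mixed: False if "a \<in> J" "b \<in> I - J" "f a = g b" for a b
        using that f(2) g(2) unfolding B_def by fastforce
      show "i = j"
        using ij mixed[of i j] mixed[of j i] f(1) g(1)
        unfolding h_def inj_on_def by (auto split: if_splits)
    qed
    moreover have "\<forall>i\<in>I. h i \<in> A i"
      using f(2) g(2) unfolding h_def B_def by auto
    ultimately show ?thesis
      by blast
  next
    case False
    have strict: "card J < card (\<Union> (A ` J))" if "J \<subset> I" "J \<noteq> {}" for J
      using False hall[of J] that by (metis le_neq_implies_less psubset_imp_subset)
    show ?thesis
    proof (cases "I = {}")
      case False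
      then obtain i where i: "i \<in> I"
        by blast
      have "card {i} \<le> card (A i)"
        using hall[of "{i}"] i by simp
      then obtain a where a: "a \<in> A i"
        by fastforce
      have cI: "card (I - {i}) < card I"
        using i fin by (intro psubset_card_mono) auto
      have "\<exists>g. inj_on g (I - {i}) \<and> (\<forall>j\<in>I - {i}. g j \<in> A j - {a})"
      proof (rule less.hyps[OF cI])
        fix K assume K: "K \<subseteq> I - {i}"
        show "card K \<le> card (\<Union>j\<in>K. A j - {a})"
        proof (cases "K = {}")
          case False
          have "K \<subset> I"
            using K i by blast
          then have "card K < card (\<Union> (A ` K))"
            using strict False by blast
          moreover have "card (\<Union>j\<in>K. A j - {a}) = card (\<Union> (A ` K) - {a})"
            by (rule arg_cong[of _ _ card]) blast
          moreover have "card (\<Union> (A ` K)) - 1 \<le> card (\<Union> (A ` K) - {a})"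
            by (simp add: card_Diff_singleton_if)
          ultimately show ?thesis
            by linarith
        qed simp
      qed (use fin finA in auto)
      then obtain g where g: "inj_on g (I - {i})" "\<forall>j\<in>I - {i}. g j \<in> A j - {a}"
        by blast
      have "inj_on (g(i := a)) I"
        using g by (auto simp: inj_on_def)
      moreover have "\<forall>j\<in>I. (g(i := a)) j \<in> A j"
        using g(2) a by auto
      ultimately show ?thesis
        by blast
    qed simp
  qed
qed

text \<open>The weight leaving \<open>J\<close> is \<open>card J * r\<close> and ends in the
  neighbourhood of \<open>J\<close>, which receives at most \<open>r\<close> per vertex; this is
  Hall's condition. Counting the total weight from both sides makes the injection a
  bijection.\<close>

lemma regular_bipartite_matching:
  fixes w :: "'a \<Rightarrow> 'b \<Rightarrow> nat"
  assumes fin: "finite X" "finite Y" and r: "r > 0"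
    and row: "\<And>x. x \<in> X \<Longrightarrow> (\<Sum>y\<in>Y. w x y) = r"
    and col: "\<And>y. y \<in> Y \<Longrightarrow> (\<Sum>x\<in>X. w x y) = r"
  obtains \<phi> where "bij_betw \<phi> X Y" "\<And>x. x \<in> X \<Longrightarrow> w x (\<phi> x) > 0"
proof -
  have "\<exists>f. inj_on f X \<and> (\<forall>x\<in>X. f x \<in> {y \<in> Y. w x y > 0})"
  proof (rule hall_marriage)
    fix J assume J: "J \<subseteq> X"
    let ?N = "\<Union>x\<in>J. {y \<in> Y. w x y > 0}"
    have N: "?N \<subseteq> Y"
      by blast
    have "card J * r = (\<Sum>x\<in>J. \<Sum>y\<in>Y. w x y)"
      using J row by (simp add: subset_iff)
    also have "\<dots> = (\<Sum>x\<in>J. \<Sum>y\<in>?N. w x y)"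
      by (intro sum.cong refl sum.mono_neutral_right) (use fin in auto)
    also have "\<dots> = (\<Sum>y\<in>?N. \<Sum>x\<in>J. w x y)"
      by (rule sum.swap)
    also have "\<dots> \<le> (\<Sum>y\<in>?N. \<Sum>x\<in>X. w x y)"
      by (intro sum_mono sum_mono2) (use J fin in auto)
    also have "\<dots> = card ?N * r"
      using N col by (simp add: subset_iff)
    finally show "card J \<le> card ?N"
      using r by simp
  qed (use fin in auto)
  then obtain f where f: "inj_on f X" "\<forall>x\<in>X. f x \<in> {y \<in> Y. w x y > 0}"
    by blast
  have "card X * r = (\<Sum>x\<in>X. \<Sum>y\<in>Y. w x y)"
    using row by simp
  also have "\<dots> = (\<Sum>y\<in>Y. \<Sum>x\<in>X. w x y)"
    by (rule sum.swap)
  also have "\<dots> = card Y * r"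
    using col by simp
  finally have "card X = card Y"
    using r by simp
  then have "f ` X = Y"
    using f fin by (intro card_subset_eq) (auto simp: card_image)
  with f that[of f] show thesis
    by (auto simp: bij_betw_def)
qed

text \<open>Perfect matchings are peeled off one at a time: if the one removed lies below the
  average cost, the remaining regular multigraph has a larger average.\<close>

lemma regular_bipartite_matching_above_average:
  fixes w c :: "'a \<Rightarrow> 'b \<Rightarrow> nat"
  assumes fin: "finite X" "finite Y" and r: "r > 0"
    and row: "\<And>x. x \<in> X \<Longrightarrow> (\<Sum>y\<in>Y. w x y) = r"
    and col: "\<And>y. y \<in> Y \<Longrightarrow> (\<Sum>x\<in>X. w x y) = r"
  shows "\<exists>\<phi>. bij_betw \<phi> X Y \<and> (\<forall>x\<in>X. w x (\<phi> x) > 0) \<and>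
    (\<Sum>x\<in>X. \<Sum>y\<in>Y. w x y * c x y) \<le> r * (\<Sum>x\<in>X. c x (\<phi> x))"
  using r row col
proof (induction r arbitrary: w)
  case (Suc r)
  obtain \<psi> where \<psi>: "bij_betw \<psi> X Y" "\<And>x. x \<in> X \<Longrightarrow> w x (\<psi> x) > 0"
    using regular_bipartite_matching[OF fin Suc.prems] by metis
  let ?W = "\<lambda>w. \<Sum>x\<in>X. \<Sum>y\<in>Y. w x y * c x y"
  let ?C = "\<lambda>\<phi>. \<Sum>x\<in>X. c x (\<phi> x)"
  \<comment> \<open>One copy of each edge of \<open>\<psi>\<close> is removed. The subtraction does
    not truncate on \<open>X\<close>, because \<open>\<psi>\<close> uses positive weights
    only.\<close>
  define v where "v x y = w x y - of_bool (y = \<psi> x)" for x y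
  have w_eq: "w x y = v x y + of_bool (y = \<psi> x)" if "x \<in> X" for x y
    using \<psi>(2)[OF that] unfolding v_def by auto
  have \<psi>_in: "\<psi> x \<in> Y" if "x \<in> X" for x
    using \<psi>(1) that by (auto simp: bij_betw_def)
  have "?W w = (\<Sum>x\<in>X. (\<Sum>y\<in>Y. v x y * c x y) + (\<Sum>y\<in>Y. if y = \<psi> x then c x y else 0))"
    by (intro sum.cong refl)
      (simp add: w_eq distrib_right sum.distrib if_distrib[of "\<lambda>t. t * _"] of_bool_def cong: if_cong)
  also have "\<dots> = ?W v + ?C \<psi>"
    using \<psi>_in fin by (simp add: sum.distrib)
  finally have W: "?W w = ?W v + ?C \<psi>" .
  show ?case
  proof (cases "?W w \<le> Suc r * ?C \<psi>")
    case True
    then show ?thesis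
      using \<psi> by blast
  next
    case False
    then have less: "r * ?C \<psi> < ?W v"
      using W by simp
    have v_row: "(\<Sum>y\<in>Y. v x y) = r" if "x \<in> X" for x
    proof -
      have "Suc r = (\<Sum>y\<in>Y. v x y + of_bool (y = \<psi> x))"
        using Suc.prems(2)[OF that] w_eq[OF that] by simp
      then show ?thesis
        using \<psi>_in[OF that] fin by (simp add: sum.distrib of_bool_def)
    qed
    have v_col: "(\<Sum>x\<in>X. v x y) = r" if y: "y \<in> Y" for y
    proof -
      have "Suc r = (\<Sum>x\<in>X. v x y + of_bool (y = \<psi> x))"
        using Suc.prems(3)[OF y] w_eq by simp
      moreover have "(\<Sum>x\<in>X. of_bool (y = \<psi> x)) = (1::nat)"
      proof -
        obtain x0 where x0: "x0 \<in> X" "y = \<psi> x0"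
          using \<psi>(1) y unfolding bij_betw_def by blast
        have "(\<Sum>x\<in>X. of_bool (y = \<psi> x)) = (\<Sum>x\<in>X. if x = x0 then 1 else (0::nat))"
          using \<psi>(1) x0 by (intro sum.cong) (auto simp: bij_betw_def inj_on_def)
        then show ?thesis
          using x0(1) fin by simp
      qed
      ultimately show ?thesis
        by (simp add: sum.distrib)
    qed
    \<comment> \<open>The induction hypothesis requires a positive \<open>r\<close>; for
      \<open>r = 0\<close> the weight \<open>v\<close> would vanish, contradicting
      \<open>less\<close>.\<close>
    have "r > 0"
    proof (rule ccontr)
      assume "\<not> r > 0"
      then have "?W v = 0"
        using v_row fin by simp
      with less show False
        by simp
    qed
    then obtain \<phi> where \<phi>: "bij_betw \<phi> X Y" "\<forall>x\<in>X. v x (\<phi> x) > 0" "?W v \<le> r * ?C \<phi>"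
      using Suc.IH[OF _ v_row v_col] by blast
    \<comment> \<open>The matching \<open>\<phi>\<close> costs at least as much as
      \<open>\<psi>\<close>, so adding the cost of \<open>\<psi>\<close> back stays within
      \<open>Suc r\<close> times the cost of \<open>\<phi>\<close>.\<close>
    have "r * ?C \<psi> < r * ?C \<phi>"
      using less \<phi>(3) by linarith
    then have "?C \<psi> \<le> ?C \<phi>"
      by simp
    then have "?W w \<le> Suc r * ?C \<phi>"
      using W \<phi>(3) by simp
    moreover have "\<forall>x\<in>X. w x (\<phi> x) > 0"
      using \<phi>(2) w_eq by (metis trans_less_add1)
    ultimately show ?thesis
      using \<phi>(1) by blast
  qed
qed simp

section \<open>Transport along an edge\<close>

text \<open>Distance 2 is encoded as distinct nonadjacent vertices with a common neighbour
  \<open>w\<close>, which keeps path metrics out of the arguments below.\<close>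

locale amply_regular_relation =
  fixes V :: "'a set" and E :: "'a \<Rightarrow> 'a \<Rightarrow> bool" and d \<alpha> \<beta> :: nat
  assumes finite_V: "finite V"
    and E_in_V: "E u v \<Longrightarrow> v \<in> V"
    and E_sym: "E u v \<Longrightarrow> E v u"
    and E_irrefl: "\<not> E u u"
    and degree: "u \<in> V \<Longrightarrow> card {v. E u v} = d"
    and common_adjacent: "E u v \<Longrightarrow> card {w. E u w \<and> E v w} = \<alpha>"
    and common_distance_two:
      "u \<noteq> v \<Longrightarrow> \<not> E u v \<Longrightarrow> E u w \<Longrightarrow> E v w \<Longrightarrow> card {w. E u w \<and> E v w} = \<beta>"
begin

definition N :: "'a \<Rightarrow> 'a set" where
  "N u = {v. E u v}"

lemma E_commute: "E u v \<longleftrightarrow> E v u"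
  using E_sym by blast

lemma N_subset: "N u \<subseteq> V"
  using E_in_V unfolding N_def by blast

lemma finite_N [simp]: "finite (N u)"
  using N_subset finite_V finite_subset by blast

lemma card_N: "u \<in> V \<Longrightarrow> card (N u) = d"
  using degree unfolding N_def .

lemma sum_N_eq: "(\<Sum>v\<in>N u. f v) = (\<Sum>v\<in>V. if E u v then f v else (0::real))"
  using finite_V N_subset[of u] by (subst sum.inter_filter[symmetric]) (auto simp: N_def intro!: sum.cong)

lemma sum_N_swap: "(\<Sum>u\<in>V. \<Sum>v\<in>N u. f u v) = (\<Sum>v\<in>V. \<Sum>u\<in>N v. f u (v::'a) :: real)"
  unfolding sum_N_eq by (subst sum.swap) (simp add: E_commute)

text \<open>The neighbours of \<open>z\<close> in \<open>N y - {x}\<close> are the common neighbours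
  of \<open>z\<close> and \<open>y\<close> other than \<open>x\<close>. There are
  \<open>\<alpha> - 1\<close> of them if \<open>z\<close> and \<open>y\<close> are adjacent, and
  then the diagonal adds \<open>\<beta> - \<alpha>\<close>; otherwise \<open>x\<close> puts
  \<open>z\<close> and \<open>y\<close> at distance 2 and there are
  \<open>\<beta> - 1\<close>.\<close>

lemma transport_row_sum:
  assumes xy: "E x y" and z: "z \<in> N x - {y}" and "\<alpha> \<le> \<beta>"
  shows "(\<Sum>z'\<in>N y - {x}. of_bool (E z z') + (\<beta> - \<alpha>) * of_bool (z = z')) = \<beta> - 1"
proof -
  have Ezx: "E z x" and Eyx: "E y x" and zy: "z \<noteq> y"
    using z xy E_sym by (auto simp: N_def)
  let ?C = "{w. E z w \<and> E y w}"
  have "(\<Sum>z'\<in>N y - {x}. of_bool (E z z')) = card (?C - {x})"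
    by (simp add: of_bool_def sum.If_cases) (auto simp: N_def intro!: arg_cong[of _ _ card])
  also have "\<dots> = card ?C - 1"
    using Ezx Eyx by (simp add: card_Diff_singleton)
  finally have adj: "(\<Sum>z'\<in>N y - {x}. of_bool (E z z')) = card ?C - 1" .
  have fin: "finite ?C"
    using finite_N[of z] by (rule finite_subset[rotated]) (auto simp: N_def)
  \<comment> \<open>As \<open>x\<close> is a common neighbour, the subtraction of 1 does not
    truncate.\<close>
  have pos: "card ?C > 0"
    using fin Ezx Eyx by (auto simp: card_gt_0_iff)
  have "(\<Sum>z'\<in>N y - {x}. (\<beta> - \<alpha>) * of_bool (z = z')) = (\<beta> - \<alpha>) * of_bool (z \<in> N y - {x})"
    by (auto simp: of_bool_def sum_distrib_left[symmetric])
  also have "z \<in> N y - {x} \<longleftrightarrow> E z y"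
    using z E_irrefl E_commute unfolding N_def by blast
  finally have diag: "(\<Sum>z'\<in>N y - {x}. (\<beta> - \<alpha>) * of_bool (z = z')) = (\<beta> - \<alpha>) * of_bool (E z y)" .
  show ?thesis
  proof (cases "E z y")
    case True
    then show ?thesis
      unfolding sum.distrib adj diag using common_adjacent[OF True] True pos \<open>\<alpha> \<le> \<beta>\<close> by simp
  next
    case False
    then show ?thesis
      unfolding sum.distrib adj diag using common_distance_two[OF zy False Ezx Eyx] False by simp
  qed
qed

text \<open>Positive weight means equal or adjacent, so the matching moves each vertex at most one
  step. The cost is the indicator of fixed points, to whose average only the \<open>\<alpha>\<close>
  common neighbours of \<open>x\<close> and \<open>y\<close> contribute.\<close>

lemma local_transport:
  assumes xy: "E x y" and "\<alpha> \<le> \<beta>" and "\<beta> \<ge> 2"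
  shows "\<exists>\<phi>. bij_betw \<phi> (N x - {y}) (N y - {x}) \<and>
    (\<forall>z\<in>N x - {y}. \<phi> z = z \<or> E z (\<phi> z)) \<and>
    (\<beta> - \<alpha>) * \<alpha> \<le> (\<beta> - 1) * (\<Sum>z\<in>N x - {y}. of_bool (\<phi> z = z))"
proof -
  let ?X = "N x - {y}" and ?Y = "N y - {x}"
  define w :: "'a \<Rightarrow> 'a \<Rightarrow> nat" where "w z z' = of_bool (E z z') + (\<beta> - \<alpha>) * of_bool (z = z')" for z z'
  have row: "(\<Sum>z'\<in>?Y. w z z') = \<beta> - 1" if "z \<in> ?X" for z
    using transport_row_sum[OF xy that \<open>\<alpha> \<le> \<beta>\<close>] unfolding w_def .
  have col: "(\<Sum>z\<in>?X. w z z') = \<beta> - 1" if "z' \<in> ?Y" for z'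
    using transport_row_sum[OF E_sym[OF xy] that \<open>\<alpha> \<le> \<beta>\<close>] unfolding w_def
    by (simp add: E_commute[of z'] eq_commute[of z'])
  have "\<exists>\<phi>. bij_betw \<phi> ?X ?Y \<and> (\<forall>z\<in>?X. w z (\<phi> z) > 0) \<and>
    (\<Sum>z\<in>?X. \<Sum>z'\<in>?Y. w z z' * of_bool (z' = z)) \<le> (\<beta> - 1) * (\<Sum>z\<in>?X. of_bool (\<phi> z = z))"
    by (rule regular_bipartite_matching_above_average) (use row col \<open>\<beta> \<ge> 2\<close> in simp_all)
  then obtain \<phi> where \<phi>: "bij_betw \<phi> ?X ?Y" "\<forall>z\<in>?X. w z (\<phi> z) > 0"
    "(\<Sum>z\<in>?X. \<Sum>z'\<in>?Y. w z z' * of_bool (z' = z)) \<le> (\<beta> - 1) * (\<Sum>z\<in>?X. of_bool (\<phi> z = z))"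
    by blast
  have "(\<Sum>z\<in>?X. \<Sum>z'\<in>?Y. w z z' * of_bool (z' = z)) = (\<Sum>z\<in>?X. \<Sum>z'\<in>?Y. if z = z' then \<beta> - \<alpha> else 0)"
    by (intro sum.cong refl) (simp add: w_def E_irrefl)
  also have "\<dots> = (\<Sum>z\<in>?X. if z \<in> ?Y then \<beta> - \<alpha> else 0)"
    by (intro sum.cong refl sum.delta) simp
  also have "\<dots> = (\<beta> - \<alpha>) * card (?X \<inter> ?Y)"
    by (subst sum.inter_restrict[symmetric]) simp_all
  also have "?X \<inter> ?Y = {w. E x w \<and> E y w}"
    using E_irrefl by (auto simp: N_def)
  finally have diag: "(\<beta> - \<alpha>) * \<alpha> \<le> (\<beta> - 1) * (\<Sum>z\<in>?X. of_bool (\<phi> z = z))"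
    using \<phi>(3) common_adjacent[OF xy] by simp
  have step: "\<phi> z = z \<or> E z (\<phi> z)" if "z \<in> ?X" for z
  proof (rule ccontr)
    assume "\<not> (\<phi> z = z \<or> E z (\<phi> z))"
    then have "w z (\<phi> z) = 0"
      by (auto simp: w_def)
    with \<phi>(2) that show False
      by (metis less_irrefl)
  qed
  show ?thesis
    using \<phi>(1) step diag by blast
qed

text \<open>Subtracting the equations at the ends of an edge with maximal difference
  \<open>L\<close> removes \<open>c\<close>. Of the \<open>d - 1\<close> transported pairs, the
  \<open>k\<close> fixed ones contribute nothing and the others at most \<open>L\<close>; the edge
  itself contributes \<open>- L\<close>.\<close>

lemma eigenvalue_curvature_bound:
  fixes F :: "'a \<Rightarrow> real"
  assumes "\<alpha> \<le> \<beta>" and "\<beta> \<ge> 2"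
    and eigen: "\<And>v. v \<in> V \<Longrightarrow> (\<Sum>w\<in>N v. F w) = \<mu> * F v + c"
    and nonconst: "E u0 v0" "F u0 \<noteq> F v0"
  shows "\<mu> \<le> real d - 2 - real_of_int \<lceil>(real \<beta> - real \<alpha>) * real \<alpha> / (real \<beta> - 1)\<rceil>"
proof -
  define Es where "Es = {(u, v). E u v}"
  define g where "g = (\<lambda>(u, v). F u - F v)"
  have "Es \<subseteq> V \<times> V"
    using E_in_V E_sym by (auto simp: Es_def)
  then have fin: "finite Es"
    using finite_V finite_subset by blast
  have "Es \<noteq> {}"
    using nonconst(1) by (auto simp: Es_def)
  with fin have "Max (g ` Es) \<in> g ` Es"
    by simp
  then obtain x y where xy: "E x y" and "Max (g ` Es) = F x - F y"
    by (auto simp: Es_def g_def)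
  then have max: "F u - F v \<le> F x - F y" if "E u v" for u v
    using Max_ge[OF finite_imageI[OF fin], of "g (u, v)" g] that by (force simp: Es_def g_def)
  define L where "L = F x - F y"
  note max = max[folded L_def]
  have L: "L > 0"
    using max[OF nonconst(1)] max[OF E_sym[OF nonconst(1)]] nonconst(2) by linarith
  have xV: "x \<in> V" and yV: "y \<in> V"
    using xy E_sym E_in_V by blast+
  let ?X = "N x - {y}" and ?Y = "N y - {x}"
  obtain \<phi> where \<phi>: "bij_betw \<phi> ?X ?Y" "\<forall>z\<in>?X. \<phi> z = z \<or> E z (\<phi> z)"
    "(\<beta> - \<alpha>) * \<alpha> \<le> (\<beta> - 1) * (\<Sum>z\<in>?X. of_bool (\<phi> z = z))"
    using local_transport[OF xy assms(1,2)] by blast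
  define k :: nat where "k = (\<Sum>z\<in>?X. of_bool (\<phi> z = z))"
  have yx: "y \<in> N x" "x \<in> N y"
    using xy E_sym by (auto simp: N_def)
  have cardX: "real (card ?X) = real d - 1"
  proof -
    have "card (N x) = Suc (card ?X)"
      using yx(1) by (rule card.remove[OF finite_N])
    then show ?thesis
      using card_N[OF xV] by simp
  qed
  have "\<mu> * L = (\<Sum>z\<in>N x. F z) - (\<Sum>z\<in>N y. F z)"
    using eigen[OF xV] eigen[OF yV] by (simp add: L_def algebra_simps)
  also have "\<dots> = (F y + (\<Sum>z\<in>?X. F z)) - (F x + (\<Sum>z\<in>?Y. F z))"
    using sum.remove[of "N x" y F] sum.remove[of "N y" x F] yx by simp
  also have "(\<Sum>z\<in>?Y. F z) = (\<Sum>z\<in>?X. F (\<phi> z))"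
    using sum.reindex_bij_betw[OF \<phi>(1)] by metis
  also have "(F y + (\<Sum>z\<in>?X. F z)) - (F x + (\<Sum>z\<in>?X. F (\<phi> z))) = (\<Sum>z\<in>?X. F z - F (\<phi> z)) - L"
    by (simp add: L_def sum_subtractf)
  also have "(\<Sum>z\<in>?X. F z - F (\<phi> z)) \<le> (\<Sum>z\<in>?X. L - L * real (of_bool (\<phi> z = z)))"
  proof (rule sum_mono)
    fix z assume "z \<in> ?X"
    then have "\<phi> z = z \<or> E z (\<phi> z)"
      using \<phi>(2) by blast
    then show "F z - F (\<phi> z) \<le> L - L * real (of_bool (\<phi> z = z))"
      using max[of z "\<phi> z"] L by (cases "\<phi> z = z") simp_all
  qed
  also have "\<dots> = (real d - 1) * L - L * real k"
    unfolding k_def of_nat_sum by (simp add: sum_subtractf sum_distrib_left cardX del: of_nat_of_bool)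
  finally have "\<mu> * L \<le> (real d - 2 - real k) * L"
    by (simp add: algebra_simps)
  then have "\<mu> \<le> real d - 2 - real k"
    using L by simp
  moreover have "(real \<beta> - real \<alpha>) * real \<alpha> / (real \<beta> - 1) \<le> real k"
  proof -
    have "real ((\<beta> - \<alpha>) * \<alpha>) \<le> real ((\<beta> - 1) * k)"
      using \<phi>(3) unfolding k_def of_nat_le_iff .
    then show ?thesis
      using assms(1,2) by (simp add: of_nat_diff field_simps)
  qed
  \<comment> \<open>The number \<open>k\<close> of fixed points is an integer, so the bound improves
    to the ceiling.\<close>
  then have "\<lceil>(real \<beta> - real \<alpha>) * real \<alpha> / (real \<beta> - 1)\<rceil> \<le> int k"
    by (simp add: ceiling_le_iff)
  then have "real_of_int \<lceil>(real \<beta> - real \<alpha>) * real \<alpha> / (real \<beta> - 1)\<rceil> \<le> real k"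
    by linarith
  ultimately show ?thesis
    by linarith
qed

end

section \<open>The curvature-dimension inequality\<close>

lemma sum_sum_square_add:
  fixes h :: "'a \<Rightarrow> real"
  shows "(\<Sum>x\<in>A. \<Sum>z\<in>A. (h z + h x)\<^sup>2) = 2 * card A * (\<Sum>x\<in>A. (h x)\<^sup>2) + 2 * (\<Sum>x\<in>A. h x)\<^sup>2"
proof -
  have "(\<Sum>x\<in>A. \<Sum>z\<in>A. (h z + h x)\<^sup>2) = (\<Sum>x\<in>A. \<Sum>z\<in>A. (h z)\<^sup>2 + (h x)\<^sup>2 + 2 * (h x * h z))"
    by (intro sum.cong refl) (simp add: power2_eq_square algebra_simps)
  also have "\<dots> = 2 * card A * (\<Sum>x\<in>A. (h x)\<^sup>2) + 2 * (\<Sum>x\<in>A. \<Sum>z\<in>A. h x * h z)"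
    by (simp add: sum.distrib flip: sum_distrib_left)
  finally show ?thesis
    by (simp add: power2_eq_square sum_product)
qed

context amply_regular_relation begin

text \<open>Two neighbours of \<open>x\<close> are equal, adjacent or at distance 2. Hence on
  \<open>N x\<close> the squared adjacency matrix is
  \<open>\<beta> J + (d - \<beta>) I + (\<alpha> - \<beta>) A\<close>, with \<open>J\<close> the
  all-ones matrix.\<close>

lemma card_common_neighbours:
  assumes "E x y" "E x y'"
  shows "real (card (N y \<inter> N y')) =
    \<beta> + (real d - \<beta>) * of_bool (y = y') + (real \<alpha> - \<beta>) * of_bool (E y y')"
proof -
  have eq: "N y \<inter> N y' = {w. E y w \<and> E y' w}"
    by (auto simp: N_def)
  consider "y = y'" | "E y y'" "y \<noteq> y'" | "y \<noteq> y'" "\<not> E y y'"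
    by blast
  then show ?thesis
  proof cases
    case 1
    then show ?thesis
      using card_N[OF E_in_V[OF assms(1)]] by (simp add: E_irrefl)
  next
    case 2
    then show ?thesis
      unfolding eq using common_adjacent[of y y'] by simp
  next
    case 3
    then show ?thesis
      unfolding eq using common_distance_two[of y y' x] assms E_sym by simp
  qed
qed

lemma sum_common_swap:
  fixes h :: "'a \<Rightarrow> 'a \<Rightarrow> real"
  shows "(\<Sum>z\<in>N x. \<Sum>y\<in>N x \<inter> N z. h y z) = (\<Sum>y\<in>N x. \<Sum>z\<in>N x \<inter> N y. h y z)"
proof -
  have "N x \<inter> N z = {y \<in> N x. E z y}" "N x \<inter> N z = {y \<in> N x. E y z}" for z
    by (auto simp: N_def E_commute)
  then show ?thesis
    using sum.swap_restrict[of "N x" "N x" "\<lambda>z y. h y z" E] by simp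
qed

text \<open>Walks of length two from \<open>x\<close> are regrouped by their endpoint
  \<open>z\<close>, including \<open>z = x\<close>, so that estimates can be made one endpoint at a
  time.\<close>

lemma sum_walks_swap:
  fixes h :: "'a \<Rightarrow> 'a \<Rightarrow> real"
  shows "(\<Sum>y\<in>N x. \<Sum>z\<in>N y. h y z) = (\<Sum>z\<in>V. \<Sum>y\<in>N x \<inter> N z. h y z)"
proof -
  have "N y = {z \<in> V. E y z}" "N x \<inter> N z = {y \<in> N x. E y z}" for y z
    by (auto simp: N_def E_commute E_in_V)
  then show ?thesis
    using sum.swap_restrict[OF finite_N finite_V, of h E x] by simp
qed

text \<open>The left side is the quadratic form of the squared adjacency matrix at \<open>g\<close>
  restricted to \<open>N x\<close>; \<open>card_common_neighbours\<close> supplies the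
  entries.\<close>

lemma sum_square_common:
  fixes g :: "'a \<Rightarrow> real"
  shows "(\<Sum>z\<in>V. (\<Sum>y\<in>N x \<inter> N z. g y)\<^sup>2) =
    \<beta> * (\<Sum>y\<in>N x. g y)\<^sup>2 + (real d - \<beta>) * (\<Sum>y\<in>N x. (g y)\<^sup>2) +
    (real \<alpha> - \<beta>) * (\<Sum>z\<in>N x. g z * (\<Sum>y\<in>N x \<inter> N z. g y))"
proof -
  let ?a = "\<lambda>y z. of_bool (E y z) :: real"
  have restrict: "(\<Sum>y\<in>N x \<inter> N z. g y) = (\<Sum>y\<in>N x. ?a y z * g y)" for z
    unfolding sum.inter_restrict[OF finite_N]
    by (intro sum.cong refl) (simp add: N_def E_commute)
  have "(\<Sum>z\<in>V. (\<Sum>y\<in>N x \<inter> N z. g y)\<^sup>2) =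
      (\<Sum>z\<in>V. \<Sum>y\<in>N x. \<Sum>y'\<in>N x. g y * g y' * (?a y z * ?a y' z))"
    unfolding restrict power2_eq_square sum_product by (simp add: mult_ac)
  also have "\<dots> = (\<Sum>y\<in>N x. \<Sum>z\<in>V. \<Sum>y'\<in>N x. g y * g y' * (?a y z * ?a y' z))"
    by (rule sum.swap)
  also have "\<dots> = (\<Sum>y\<in>N x. \<Sum>y'\<in>N x. \<Sum>z\<in>V. g y * g y' * (?a y z * ?a y' z))"
    by (rule sum.cong[OF refl]) (rule sum.swap)
  also have "\<dots> = (\<Sum>y\<in>N x. \<Sum>y'\<in>N x. g y * g y' * real (card (N y \<inter> N y')))"
  proof (intro sum.cong refl)
    fix y y'
    have "(\<Sum>z\<in>V. ?a y z * ?a y' z) = (\<Sum>z\<in>V. if z \<in> N y \<inter> N y' then 1 else 0)"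
      by (intro sum.cong) (auto simp: N_def)
    also have "\<dots> = real (card (V \<inter> (N y \<inter> N y')))"
      using finite_V by (subst sum.inter_restrict[symmetric]) simp_all
    also have "V \<inter> (N y \<inter> N y') = N y \<inter> N y'"
      using N_subset by blast
    finally show "(\<Sum>z\<in>V. g y * g y' * (?a y z * ?a y' z)) = g y * g y' * real (card (N y \<inter> N y'))"
      by (simp add: sum_distrib_left[symmetric])
  qed
  also have "\<dots> = (\<Sum>y\<in>N x. \<Sum>y'\<in>N x. \<beta> * (g y * g y') +
      (real d - \<beta>) * (if y = y' then (g y)\<^sup>2 else 0) + (real \<alpha> - \<beta>) * (g y * (?a y' y * g y')))"
    by (intro sum.cong refl, subst card_common_neighbours[of x])
      (auto simp: N_def E_commute power2_eq_square algebra_simps)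
  also have "\<dots> = \<beta> * (\<Sum>y\<in>N x. g y)\<^sup>2 + (real d - \<beta>) * (\<Sum>y\<in>N x. (g y)\<^sup>2) +
      (real \<alpha> - \<beta>) * (\<Sum>y\<in>N x. g y * (\<Sum>y'\<in>N x. ?a y' y * g y'))"
    by (simp add: sum.distrib sum_distrib_left[symmetric] power2_eq_square sum_product[symmetric]
        sum_distrib_right[symmetric])
  finally show ?thesis
    unfolding restrict .
qed

text \<open>
  On functions orthogonal to the constants this is \<open>\<mu>'\<^sup>2 - \<alpha> \<mu>' \<ge> - \<alpha>\<^sup>2 / 4\<close> for the eigenvalues \<open>\<mu>'\<close>
  of the local graph at \<open>x\<close>.
\<close>

lemma local_graph_inequality:
  fixes g :: "'a \<Rightarrow> real"
  assumes x: "x \<in> V" and d: "d > 0"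
  defines "r \<equiv> \<lambda>z. \<Sum>y\<in>N x \<inter> N z. g y"
  shows "\<alpha> * (\<Sum>z\<in>N x. g z * r z) \<le> (\<Sum>z\<in>N x. (r z)\<^sup>2) +
    (real \<alpha>)\<^sup>2 / 4 * ((\<Sum>z\<in>N x. (g z)\<^sup>2) - (\<Sum>z\<in>N x. g z)\<^sup>2 / d)"
proof -
  define s where "s = (\<Sum>z\<in>N x. g z)"
  have "(\<Sum>z\<in>N x. r z) = (\<Sum>y\<in>N x. \<Sum>z\<in>N x \<inter> N y. g y)"
    unfolding r_def by (rule sum_common_swap)
  also have "\<dots> = (\<Sum>y\<in>N x. \<alpha> * g y)"
  proof (intro sum.cong refl)
    fix y assume "y \<in> N x"
    then have "card (N x \<inter> N y) = \<alpha>"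
      using common_adjacent[of x y] by (simp add: N_def Int_def)
    then show "(\<Sum>z\<in>N x \<inter> N y. g y) = \<alpha> * g y"
      by simp
  qed
  finally have sum_r: "(\<Sum>z\<in>N x. r z) = \<alpha> * s"
    by (simp add: s_def sum_distrib_left)
  \<comment> \<open>This is the mean of \<open>r z - \<alpha> / 2 * g z\<close> over
    \<open>N x\<close>; subtracting it projects away the constants.\<close>
  define t where "t = \<alpha> * s / (2 * d)"
  have "0 \<le> (\<Sum>z\<in>N x. (r z - \<alpha> / 2 * g z - t)\<^sup>2)"
    by (intro sum_nonneg) simp
  also have "\<dots> = (\<Sum>z\<in>N x. (r z)\<^sup>2 + (real \<alpha>)\<^sup>2 / 4 * (g z)\<^sup>2 + t\<^sup>2 - \<alpha> * (g z * r z)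
      - 2 * t * r z + \<alpha> * t * g z)"
    by (intro sum.cong refl) (simp add: power2_eq_square algebra_simps)
  also have "\<dots> = (\<Sum>z\<in>N x. (r z)\<^sup>2) + (real \<alpha>)\<^sup>2 / 4 * (\<Sum>z\<in>N x. (g z)\<^sup>2) + d * t\<^sup>2
      - \<alpha> * (\<Sum>z\<in>N x. g z * r z) - 2 * t * (\<alpha> * s) + \<alpha> * t * s"
    by (simp add: sum.distrib sum_subtractf sum_distrib_left[symmetric]
        sum_divide_distrib[symmetric] sum_r s_def card_N[OF x])
  also have "d * t\<^sup>2 = (real \<alpha>)\<^sup>2 / 4 * (s\<^sup>2 / d)"
    using d by (simp add: t_def power2_eq_square field_simps)
  also have "2 * t * (\<alpha> * s) = (real \<alpha>)\<^sup>2 * (s\<^sup>2 / d)"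
    using d by (simp add: t_def power2_eq_square field_simps)
  also have "\<alpha> * t * s = (real \<alpha>)\<^sup>2 / 2 * (s\<^sup>2 / d)"
    using d by (simp add: t_def power2_eq_square field_simps)
  finally show ?thesis
    unfolding s_def[symmetric] by (simp add: algebra_simps)
qed

text \<open>
  This is the inequality \<open>\<Gamma>\<^sub>2(g) \<ge> (2 + \<alpha>/2) \<Gamma>(g)\<close> at \<open>x\<close>, multiplied by 4. The
  contribution of a vertex \<open>z\<close> at distance 2 is minimized over the value \<open>g z\<close>.
\<close>

lemma curvature_dimension_inequality:
  fixes g :: "'a \<Rightarrow> real" and S :: real
  assumes x: "x \<in> V" and d: "d > 0" and \<beta>: "\<beta> \<ge> 2" and gx: "g x = 0"
    and small: "(real \<alpha>)\<^sup>2 \<le> 2 * (real \<beta> - 2) * d"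
  defines "S \<equiv> \<Sum>y\<in>N x. (g y)\<^sup>2"
  shows "(4 + real \<alpha>) * S \<le>
    (\<Sum>y\<in>N x. \<Sum>z\<in>N y. (g z - 2 * g y)\<^sup>2) - 2 * d * S + 2 * (\<Sum>y\<in>N x. g y)\<^sup>2"
proof -
  define s where "s = (\<Sum>y\<in>N x. g y)"
  define r where "r z = (\<Sum>y\<in>N x \<inter> N z. g y)" for z
  define q where "q z = (\<Sum>y\<in>N x \<inter> N z. (g y)\<^sup>2)" for z
  define T where "T = (\<Sum>z\<in>N x. g z * r z)"
  define U where "U = (\<Sum>z\<in>N x. (r z)\<^sup>2)"
  \<comment> \<open>For \<open>z\<close> at distance 2, minimizing over \<open>g z\<close> leaves
    \<open>4 * q z - 4 / \<beta> * (r z)\<^sup>2\<close>. The correction \<open>e z\<close> makes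
    this expression exact at \<open>x\<close> and on \<open>N x\<close>, so that one formula can be
    summed over all of \<open>V\<close>.\<close>
  define e where "e z = (if z = x then 4 / \<beta> * s\<^sup>2
      else if z \<in> N x then \<alpha> * (g z)\<^sup>2 - 4 * (g z * r z) + 4 / \<beta> * (r z)\<^sup>2 else 0)" for z
  have \<beta>0: "real \<beta> > 0"
    using \<beta> by simp
  have x_notin: "x \<notin> N x"
    by (simp add: N_def E_irrefl)
  have expand: "(\<Sum>y\<in>N x \<inter> N z. (g z - 2 * g y)\<^sup>2) =
      card (N x \<inter> N z) * (g z)\<^sup>2 - 4 * (g z * r z) + 4 * q z" for z
  proof -
    have "(\<Sum>y\<in>N x \<inter> N z. (g z - 2 * g y)\<^sup>2) =
        (\<Sum>y\<in>N x \<inter> N z. (g z)\<^sup>2 - 4 * g z * g y + 4 * (g y)\<^sup>2)"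
      by (intro sum.cong refl) (simp add: power2_eq_square algebra_simps)
    then show ?thesis
      by (simp add: r_def q_def sum.distrib sum_subtractf sum_distrib_left[symmetric])
  qed
  have vertex: "4 * q z - 4 / \<beta> * (r z)\<^sup>2 + e z \<le> (\<Sum>y\<in>N x \<inter> N z. (g z - 2 * g y)\<^sup>2)" for z
  proof -
    consider "z = x" | "z \<in> N x" "z \<noteq> x" | "z \<notin> N x" "z \<noteq> x" "N x \<inter> N z = {}"
      | "z \<notin> N x" "z \<noteq> x" "N x \<inter> N z \<noteq> {}"
      by blast
    then show ?thesis
    proof cases
      case 1
      then show ?thesis
        unfolding expand by (simp add: e_def gx s_def r_def)
    next
      case 2
      then have "card (N x \<inter> N z) = \<alpha>"
        using common_adjacent[of x z] by (simp add: N_def Int_def)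
      then show ?thesis
        unfolding expand using 2 by (simp add: e_def)
    next
      case 3
      then show ?thesis
        by (simp add: e_def q_def r_def)
    next
      case 4
      then obtain y where "E x y" "E z y"
        by (auto simp: N_def)
      then have "card (N x \<inter> N z) = \<beta>"
        using common_distance_two[of x z y] 4 by (simp add: N_def Int_def)
      \<comment> \<open>Completing the square; the minimum is at
        \<open>g z = 2 * r z / \<beta>\<close>.\<close>
      moreover have "0 \<le> (\<beta> * g z - 2 * r z)\<^sup>2 / \<beta>"
        by simp
      then have "0 \<le> \<beta> * (g z)\<^sup>2 - 4 * (g z * r z) + 4 / \<beta> * (r z)\<^sup>2"
        using \<beta>0 by (simp add: power2_eq_square field_simps)
      ultimately show ?thesis
        unfolding expand using 4 by (simp add: e_def)
    qed
  qed
  have sum_q: "(\<Sum>z\<in>V. q z) = d * S"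
  proof -
    have "(\<Sum>z\<in>V. q z) = (\<Sum>y\<in>N x. \<Sum>z\<in>N y. (g y)\<^sup>2)"
      unfolding q_def by (rule sum_walks_swap[symmetric])
    also have "\<dots> = (\<Sum>y\<in>N x. d * (g y)\<^sup>2)"
    proof (intro sum.cong refl)
      fix y assume "y \<in> N x"
      then have "card (N y) = d"
        using card_N N_subset by blast
      then show "(\<Sum>z\<in>N y. (g y)\<^sup>2) = d * (g y)\<^sup>2"
        by simp
    qed
    finally show ?thesis
      by (simp add: S_def sum_distrib_left)
  qed
  have sum_r: "(\<Sum>z\<in>V. (r z)\<^sup>2) = \<beta> * s\<^sup>2 + (real d - \<beta>) * S + (real \<alpha> - \<beta>) * T"
    unfolding r_def T_def s_def S_def by (rule sum_square_common)
  have sum_e: "(\<Sum>z\<in>V. e z) = 4 / \<beta> * s\<^sup>2 + \<alpha> * S - 4 * T + 4 / \<beta> * U"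
  proof -
    have "(\<Sum>z\<in>V. e z) = (\<Sum>z\<in>insert x (N x). e z)"
      using x N_subset finite_V by (intro sum.mono_neutral_right) (auto simp: e_def)
    also have "\<dots> = e x + (\<Sum>z\<in>N x. e z)"
      using x_notin by simp
    also have "(\<Sum>z\<in>N x. e z) = (\<Sum>z\<in>N x. \<alpha> * (g z)\<^sup>2 - 4 * (g z * r z) + 4 / \<beta> * (r z)\<^sup>2)"
      using x_notin by (intro sum.cong) (auto simp: e_def)
    also have "\<dots> = \<alpha> * S - 4 * T + 4 / \<beta> * U"
      by (simp add: S_def T_def U_def sum.distrib sum_subtractf sum_distrib_left)
    finally show ?thesis
      by (simp add: e_def)
  qed
  have "(\<Sum>z\<in>V. 4 * q z - 4 / \<beta> * (r z)\<^sup>2 + e z) \<le> (\<Sum>y\<in>N x. \<Sum>z\<in>N y. (g z - 2 * g y)\<^sup>2)"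
    unfolding sum_walks_swap by (intro sum_mono vertex)
  moreover have "(\<Sum>z\<in>V. 4 * q z - 4 / \<beta> * (r z)\<^sup>2 + e z) =
      4 * (\<Sum>z\<in>V. q z) - 4 / \<beta> * (\<Sum>z\<in>V. (r z)\<^sup>2) + (\<Sum>z\<in>V. e z)"
    by (simp add: sum.distrib sum_subtractf sum_distrib_left)
  ultimately have lower: "4 * (d * S) - 4 / \<beta> * (\<beta> * s\<^sup>2 + (real d - \<beta>) * S + (real \<alpha> - \<beta>) * T) +
      (4 / \<beta> * s\<^sup>2 + \<alpha> * S - 4 * T + 4 / \<beta> * U) \<le> (\<Sum>y\<in>N x. \<Sum>z\<in>N y. (g z - 2 * g y)\<^sup>2)"
    unfolding sum_q sum_r sum_e by simp
  \<comment> \<open>Nonnegativity of the variance of \<open>g\<close> on \<open>N x\<close> allows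
    \<open>small\<close> to be applied to its coefficient.\<close>
  have var: "0 \<le> S - s\<^sup>2 / d"
  proof -
    have "0 \<le> (\<Sum>y\<in>N x. (g y - s / d)\<^sup>2)"
      by (intro sum_nonneg) simp
    also have "\<dots> = (\<Sum>y\<in>N x. (g y)\<^sup>2 - 2 * (s / d) * g y + (s / d)\<^sup>2)"
      by (intro sum.cong refl) (simp add: power2_eq_square algebra_simps)
    also have "\<dots> = S - 2 * (s / d) * s + d * (s / d)\<^sup>2"
      by (simp add: S_def s_def card_N[OF x] sum.distrib sum_subtractf sum_distrib_left)
    also have "\<dots> = S - s\<^sup>2 / d"
      using d by (simp add: power2_eq_square field_simps)
    finally show ?thesis .
  qed
  have "\<alpha> * T \<le> U + (real \<alpha>)\<^sup>2 / 4 * (S - s\<^sup>2 / d)"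
    using local_graph_inequality[OF x d] unfolding T_def U_def S_def s_def r_def .
  also have "\<dots> \<le> U + (2 * (real \<beta> - 2) * d) / 4 * (S - s\<^sup>2 / d)"
    using small var by (intro add_left_mono mult_right_mono divide_right_mono) auto
  also have "\<dots> = U + (real \<beta> - 2) / 2 * (d * S - s\<^sup>2)"
    using d by (simp add: field_simps)
  finally have "0 \<le> 2 / \<beta> * ((real \<beta> - 2) * (d * S - s\<^sup>2) - 2 * \<alpha> * T + 2 * U)"
    using \<beta>0 by simp
  \<comment> \<open>The constant \<open>4 + \<alpha>\<close> comes from here: \<open>4 * S\<close>
    arises from \<open>sum_r\<close> and \<open>\<alpha> * S\<close> from \<open>sum_e\<close>, and
    subtracting \<open>(4 + \<alpha>) * S\<close> cancels both.\<close>
  also have "\<dots> = 4 * (d * S) - 4 / \<beta> * (\<beta> * s\<^sup>2 + (real d - \<beta>) * S + (real \<alpha> - \<beta>) * T) +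
      (4 / \<beta> * s\<^sup>2 + \<alpha> * S - 4 * T + 4 / \<beta> * U) - 2 * d * S + 2 * s\<^sup>2 - (4 + real \<alpha>) * S"
    using \<beta>0 by (simp add: field_simps)
  finally show ?thesis
    using lower unfolding s_def by linarith
qed

text \<open>The pointwise inequality is summed over all vertices. Regrouping by the middle vertex
  cancels the terms with \<open>d\<close> and leaves
  \<open>(4 + \<alpha>) * (2 * l * Q) \<le> (2 * l) * (2 * l * Q)\<close> for the Laplacian
  eigenvalue \<open>l = d - \<mu>\<close>, which is positive.\<close>

lemma eigenvalue_bochner_bound:
  fixes F :: "'a \<Rightarrow> real" and \<mu> :: real
  assumes d: "d > 0" and \<beta>: "\<beta> \<ge> 2" and small: "(real \<alpha>)\<^sup>2 \<le> 2 * (real \<beta> - 2) * d"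
    and eigen: "\<And>v. v \<in> V \<Longrightarrow> (\<Sum>w\<in>N v. F w) = \<mu> * F v"
    and nonzero: "v0 \<in> V" "F v0 \<noteq> 0" and \<mu>: "\<mu> < d"
  shows "\<mu> \<le> real d - 2 - \<alpha> / 2"
proof -
  define l where "l = real d - \<mu>"
  define Q where "Q = (\<Sum>v\<in>V. (F v)\<^sup>2)"
  define H where "H v = (\<Sum>w\<in>N v. (F w - F v)\<^sup>2)" for v
  have Q: "Q > 0"
    unfolding Q_def using finite_V nonzero by (intro sum_pos2[of V v0]) auto
  have laplace: "(\<Sum>w\<in>N v. F w - F v) = - l * F v" if "v \<in> V" for v
    using eigen[OF that] card_N[OF that] by (simp add: sum_subtractf l_def algebra_simps)
  have sum_H: "(\<Sum>v\<in>V. H v) = 2 * l * Q"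
  proof -
    have "(\<Sum>v\<in>V. H v) = (\<Sum>v\<in>V. \<Sum>w\<in>N v. (F w)\<^sup>2) + (\<Sum>v\<in>V. \<Sum>w\<in>N v. (F v)\<^sup>2 - 2 * F v * F w)"
      unfolding H_def sum.distrib[symmetric]
      by (intro sum.cong refl) (simp add: power2_eq_square algebra_simps)
    also have "(\<Sum>v\<in>V. \<Sum>w\<in>N v. (F w)\<^sup>2) = (\<Sum>w\<in>V. \<Sum>v\<in>N w. (F w)\<^sup>2)"
      by (rule sum_N_swap)
    also have "\<dots> = d * Q"
      by (simp add: card_N Q_def sum_distrib_left)
    also have "(\<Sum>v\<in>V. \<Sum>w\<in>N v. (F v)\<^sup>2 - 2 * F v * F w) = (\<Sum>v\<in>V. (real d - 2 * \<mu>) * (F v)\<^sup>2)"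
    proof (intro sum.cong refl)
      fix v assume v: "v \<in> V"
      have "(\<Sum>w\<in>N v. (F v)\<^sup>2 - 2 * F v * F w) = d * (F v)\<^sup>2 - 2 * F v * (\<Sum>w\<in>N v. F w)"
        by (simp add: sum_subtractf sum_distrib_left card_N[OF v])
      then show "(\<Sum>w\<in>N v. (F v)\<^sup>2 - 2 * F v * F w) = (real d - 2 * \<mu>) * (F v)\<^sup>2"
        unfolding eigen[OF v] by (simp add: power2_eq_square algebra_simps)
    qed
    also have "\<dots> = (real d - 2 * \<mu>) * Q"
      by (simp add: Q_def sum_distrib_left)
    finally show ?thesis
      by (simp add: l_def algebra_simps)
  qed
  have pointwise: "(4 + real \<alpha>) * H x \<le>
      (\<Sum>y\<in>N x. \<Sum>z\<in>N y. (F z - 2 * F y + F x)\<^sup>2) - 2 * d * H x + 2 * l\<^sup>2 * (F x)\<^sup>2" if "x \<in> V" for x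
  proof -
    have "(F z - F x - 2 * (F y - F x))\<^sup>2 = (F z - 2 * F y + F x)\<^sup>2" for y z
      by (rule arg_cong[of _ _ "\<lambda>t. t\<^sup>2"]) simp
    then show ?thesis
      using curvature_dimension_inequality[OF that d \<beta> _ small, of "\<lambda>y. F y - F x"]
      unfolding laplace[OF that] H_def by (simp only: power_mult_distrib) simp
  qed
  \<comment> \<open>Seen from the middle vertex \<open>y\<close>, the second difference is a sum of
    two increments, one towards \<open>x\<close> and one towards \<open>z\<close>.\<close>
  have second: "(\<Sum>x\<in>N y. \<Sum>z\<in>N y. (F z - 2 * F y + F x)\<^sup>2) = 2 * d * H y + 2 * l\<^sup>2 * (F y)\<^sup>2"
    if y: "y \<in> V" for y
  proof -
    let ?h = "\<lambda>z. F z - F y"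
    have "(\<Sum>x\<in>N y. \<Sum>z\<in>N y. (F z - 2 * F y + F x)\<^sup>2) =
        (\<Sum>x\<in>N y. \<Sum>z\<in>N y. (?h z + ?h x)\<^sup>2)"
      by (intro sum.cong refl arg_cong[of _ _ "\<lambda>t. t\<^sup>2"]) simp
    also have "\<dots> = 2 * d * H y + 2 * (\<Sum>z\<in>N y. ?h z)\<^sup>2"
      unfolding sum_sum_square_add H_def card_N[OF y] ..
    finally show ?thesis
      unfolding laplace[OF y] by (simp add: power2_eq_square algebra_simps)
  qed
  have "(4 + real \<alpha>) * (2 * l * Q) = (\<Sum>x\<in>V. (4 + real \<alpha>) * H x)"
    unfolding sum_distrib_left[symmetric] sum_H ..
  also have "\<dots> \<le> (\<Sum>x\<in>V. (\<Sum>y\<in>N x. \<Sum>z\<in>N y. (F z - 2 * F y + F x)\<^sup>2) - 2 * d * H x + 2 * l\<^sup>2 * (F x)\<^sup>2)"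
    by (intro sum_mono pointwise)
  also have "\<dots> = (\<Sum>x\<in>V. \<Sum>y\<in>N x. \<Sum>z\<in>N y. (F z - 2 * F y + F x)\<^sup>2) - 2 * d * (2 * l * Q) + 2 * l\<^sup>2 * Q"
    by (simp add: sum.distrib sum_subtractf sum_H Q_def flip: sum_distrib_left)
  also have "(\<Sum>x\<in>V. \<Sum>y\<in>N x. \<Sum>z\<in>N y. (F z - 2 * F y + F x)\<^sup>2) =
      (\<Sum>y\<in>V. \<Sum>x\<in>N y. \<Sum>z\<in>N y. (F z - 2 * F y + F x)\<^sup>2)"
    by (rule sum_N_swap)
  also have "\<dots> = (\<Sum>y\<in>V. 2 * d * H y + 2 * l\<^sup>2 * (F y)\<^sup>2)"
    by (intro sum.cong refl second)
  also have "\<dots> = 2 * d * (2 * l * Q) + 2 * l\<^sup>2 * Q"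
    by (simp add: sum.distrib sum_H Q_def flip: sum_distrib_left)
  finally have "(4 + real \<alpha>) * (2 * l * Q) \<le> (2 * l) * (2 * l * Q)"
    by (simp add: power2_eq_square algebra_simps)
  then have "4 + real \<alpha> \<le> 2 * l"
    using Q \<mu> by (simp add: l_def)
  then show ?thesis
    by (simp add: l_def)
qed

end

section \<open>Nontrivial eigenvalues\<close>

context amply_regular_relation begin

text \<open>The equations at a maximum and a minimum of \<open>F\<close> are subtracted, so
  \<open>c\<close> cancels and the neighbour sums are bounded by \<open>d\<close> times the extreme
  values.\<close>

lemma eigenvalue_le_degree:
  fixes F :: "'a \<Rightarrow> real" and \<mu> :: real
  assumes eigen: "\<And>v. v \<in> V \<Longrightarrow> (\<Sum>w\<in>N v. F w) = \<mu> * F v + c"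
    and nonconst: "u0 \<in> V" "v0 \<in> V" "F u0 \<noteq> F v0"
  shows "\<mu> \<le> d"
proof -
  have fin: "finite (F ` V)" "F ` V \<noteq> {}"
    using finite_V nonconst(1) by auto
  obtain x where x: "x \<in> V" "Max (F ` V) = F x"
    using Max_in[OF fin] by blast
  obtain y where y: "y \<in> V" "Min (F ` V) = F y"
    using Min_in[OF fin] by blast
  have le: "F v \<le> F x" and ge: "F y \<le> F v" if "v \<in> V" for v
    using that fin(1) by (simp_all flip: x(2) y(2))
  have "F x - F y > 0"
    using nonconst le[of u0] le[of v0] ge[of u0] ge[of v0] by linarith
  moreover have "\<mu> * (F x - F y) = (\<Sum>w\<in>N x. F w) - (\<Sum>w\<in>N y. F w)"
    using eigen x(1) y(1) by (simp add: algebra_simps)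
  moreover have "(\<Sum>w\<in>N x. F w) \<le> real (card (N x)) * F x"
    by (rule sum_bounded_above) (meson le N_subset subsetD)
  moreover have "real (card (N y)) * F y \<le> (\<Sum>w\<in>N y. F w)"
    by (rule sum_bounded_below) (meson ge N_subset subsetD)
  ultimately have "\<mu> * (F x - F y) \<le> d * (F x - F y)"
    using card_N[OF x(1)] card_N[OF y(1)] by (simp add: algebra_simps)
  with \<open>F x - F y > 0\<close> show ?thesis
    by simp
qed

text \<open>The vertex \<open>a\<close> is adjacent to \<open>u\<close>, to \<open>b\<close> and to
  its \<open>\<alpha>\<close> common neighbours with \<open>u\<close>, which are all
  different.\<close>

lemma degree_ge:
  assumes "E u a" "E a b" "u \<noteq> b" "\<not> E u b"
  shows "\<alpha> + 2 \<le> d"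
proof -
  let ?C = "{w. E u w \<and> E a w}"
  have sub: "insert u (insert b ?C) \<subseteq> N a"
    using assms E_sym by (auto simp: N_def)
  have "finite ?C"
    by (rule finite_subset[OF _ finite_N[of a]]) (auto simp: N_def)
  moreover have "u \<notin> ?C" "b \<notin> ?C"
    using assms(4) E_irrefl by auto
  ultimately have "card (insert u (insert b ?C)) = \<alpha> + 2"
    using assms(3) common_adjacent[OF assms(1)] by simp
  moreover have "a \<in> V"
    using assms(1) E_in_V by blast
  ultimately show ?thesis
    using card_mono[OF finite_N sub] card_N by simp
qed

lemma beta_pos:
  assumes "E u a" "E a b" "u \<noteq> b" "\<not> E u b"
  shows "\<beta> > 0"
proof -
  have "finite {w. E u w \<and> E b w}"
    by (rule finite_subset[OF _ finite_N[of u]]) (auto simp: N_def)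
  moreover have "a \<in> {w. E u w \<and> E b w}"
    using assms E_sym by blast
  ultimately have "card {w. E u w \<and> E b w} > 0"
    by (metis card_gt_0_iff empty_iff)
  then show ?thesis
    using common_distance_two[OF assms(3,4,1)] E_sym[OF assms(2)] by simp
qed

lemma nontrivial_eigenvalue_bound:
  fixes F :: "'a \<Rightarrow> real" and \<mu> :: real
  assumes path: "E u a" "E a b" "u \<noteq> b" "\<not> E u b"
    and \<beta>: "\<beta> \<ge> 2" "\<alpha> \<le> \<beta>" and excl: "(\<alpha>, \<beta>) \<noteq> (2, 2)"
    and eigen: "\<And>v. v \<in> V \<Longrightarrow> (\<Sum>w\<in>N v. F w) = \<mu> * F v + c"
    and nonconst: "E u0 v0" "F u0 \<noteq> F v0"
  shows "\<mu> \<le> real d - 2 - max (real \<alpha> / 2)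
    (real_of_int \<lceil>(real \<beta> - real \<alpha>) * real \<alpha> / (real \<beta> - 1)\<rceil>)"
proof -
  let ?k = "real_of_int \<lceil>(real \<beta> - real \<alpha>) * real \<alpha> / (real \<beta> - 1)\<rceil>"
  have curv: "\<mu> \<le> real d - 2 - ?k"
    by (rule eigenvalue_curvature_bound[OF \<beta>(2,1) eigen nonconst])
  have d: "\<alpha> + 2 \<le> d"
    by (rule degree_ge[OF path])
  have "\<mu> \<le> real d - 2 - \<alpha> / 2"
  proof (cases "\<beta> = 2")
    case True
    \<comment> \<open>For \<open>\<alpha> = 1\<close> and \<open>\<beta> = 2\<close> the ceiling is
      1, so the transport bound already exceeds the requirement; for \<open>\<alpha> = 0\<close>
      both terms vanish.\<close>
    then have "\<alpha> = 0 \<or> \<alpha> = 1"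
      using \<beta> excl by auto
    with True curv show ?thesis
      by auto
  next
    case False
    \<comment> \<open>For \<open>\<beta> \<ge> 4\<close> this follows from
      \<open>\<alpha> \<le> \<beta> \<le> 2 * (\<beta> - 2)\<close> and
      \<open>\<alpha> \<le> d\<close>. For \<open>\<beta> = 3\<close> the bound
      \<open>\<alpha> + 2 \<le> d\<close> is needed: \<open>\<alpha> = 3\<close> gives
      \<open>9 \<le> 2 * d\<close> because \<open>d \<ge> 5\<close>.\<close>
    have "\<alpha> * \<alpha> \<le> 2 * (\<beta> - 2) * d"
    proof (cases "\<beta> = 3")
      case True
      then have "\<alpha> \<in> {0, 1, 2, 3}"
        using \<beta> by auto
      with True d show ?thesis
        by auto
    next
      case False
      then have "\<alpha> \<le> 2 * (\<beta> - 2)"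
        using \<beta> \<open>\<beta> \<noteq> 2\<close> by linarith
      with d show ?thesis
        by (intro mult_mono) auto
    qed
    then have "real (\<alpha> * \<alpha>) \<le> real (2 * (\<beta> - 2) * d)"
      unfolding of_nat_le_iff .
    then have small: "(real \<alpha>)\<^sup>2 \<le> 2 * (real \<beta> - 2) * d"
      using \<beta> by (simp add: power2_eq_square of_nat_diff)
    have "(real \<beta> - real \<alpha>) * real \<alpha> / (real \<beta> - 1) \<ge> 0"
      using \<beta> by simp
    then have "?k \<ge> 0"
      by (simp add: le_ceiling_iff)
    with curv have \<mu>: "\<mu> < d"
      by linarith
    \<comment> \<open>Subtracting \<open>t\<close> turns \<open>F\<close> into a genuine
      eigenfunction; the division is legitimate because the transport bound gives
      \<open>\<mu> < d\<close>.\<close>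
    define t where "t = c / (d - \<mu>)"
    have t: "c = t * (d - \<mu>)"
      using \<mu> by (simp add: t_def)
    have "(\<Sum>w\<in>N v. F w - t) = \<mu> * (F v - t)" if "v \<in> V" for v
      using eigen[OF that] card_N[OF that] t by (simp add: sum_subtractf algebra_simps)
    moreover obtain v where "v \<in> V" "F v - t \<noteq> 0"
      using nonconst E_in_V E_sym by (metis eq_iff_diff_eq_0)
    ultimately show ?thesis
      using eigenvalue_bochner_bound[of "\<lambda>v. F v - t" \<mu> v] d \<beta> small \<mu> by auto
  qed
  with curv show ?thesis
    by (simp add: max_def)
qed

end

section \<open>Eigenvalues on the quotient by the constants\<close>

text \<open>
  The change of basis replacing the first standard basis vector by the all-ones vector; \<open>B\<close> is the
  action of \<open>A\<close> on the quotient by the constants.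
\<close>

lemma char_poly_constant_row_sum:
  fixes A :: "'a :: field mat"
  assumes A: "A \<in> carrier_mat (Suc k) (Suc k)"
    and row: "\<And>i. i < Suc k \<Longrightarrow> (\<Sum>j<Suc k. A $$ (i, j)) = d"
  defines "B \<equiv> mat k k (\<lambda>(i, j). A $$ (Suc i, Suc j) - A $$ (0, Suc j))"
  shows "char_poly A = [:- d, 1:] * char_poly B"
proof -
  let ?m = "Suc k"
  \<comment> \<open>The first column of \<open>P\<close> is the all-ones vector; multiplying by
    \<open>P\<close> on the left adds row 0 to every other row, and \<open>Q\<close> undoes
    this.\<close>
  define P where "P = mat ?m ?m (\<lambda>(i, j). if j = 0 \<or> i = j then 1 else 0 :: 'a)"
  define Q where "Q = mat ?m ?m (\<lambda>(i, j). if i = j then 1 else if j = 0 then - 1 else 0 :: 'a)"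
  define M where "M = four_block_mat (mat 1 1 (\<lambda>_. d)) (mat 1 k (\<lambda>(i, j). A $$ (0, Suc j))) (0\<^sub>m k 1) B"
  have carr: "P \<in> carrier_mat ?m ?m" "Q \<in> carrier_mat ?m ?m" "M \<in> carrier_mat ?m ?m"
    by (auto simp: P_def Q_def M_def B_def)
  have P_mult: "(P * X) $$ (i, j) = X $$ (0, j) + (if i = 0 then 0 else X $$ (i, j))"
    if "X \<in> carrier_mat ?m ?m" "i < ?m" "j < ?m" for X i j
  proof -
    have "(P * X) $$ (i, j) = (\<Sum>l<?m. P $$ (i, l) * X $$ (l, j))"
      using that carr(1) by (simp add: scalar_prod_def atLeast0LessThan del: sum.lessThan_Suc)
    also have "\<dots> = (\<Sum>l<?m. (if l = 0 then X $$ (0, j) else 0) +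
        (if l = i then if i = 0 then 0 else X $$ (i, j) else 0))"
      by (intro sum.cong refl) (use that in \<open>auto simp: P_def\<close>)
    finally show ?thesis
      using that(2) by (simp add: sum.distrib del: sum.lessThan_Suc)
  qed
  have PQ: "P * Q = 1\<^sub>m ?m"
  proof (rule eq_matI)
    fix i j assume "i < dim_row (1\<^sub>m ?m :: 'a mat)" "j < dim_col (1\<^sub>m ?m :: 'a mat)"
    then show "(P * Q) $$ (i, j) = 1\<^sub>m ?m $$ (i, j)"
      using P_mult[OF carr(2)] by (simp add: Q_def)
  qed (use carr in auto)
  have QP: "Q * P = 1\<^sub>m ?m"
    by (rule mat_mult_left_right_inverse[OF carr(1,2) PQ])
  \<comment> \<open>Column 0 of \<open>A * P\<close> holds the row sums, while adding row 0 of
    \<open>M\<close> to the others reverses the subtraction in \<open>B\<close>.\<close>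
  have AP: "A * P = P * M"
  proof (rule eq_matI)
    fix i j assume "i < dim_row (P * M)" "j < dim_col (P * M)"
    then have ij: "i < ?m" "j < ?m"
      using carr by auto
    have "(A * P) $$ (i, j) = (if j = 0 then d else A $$ (i, j))"
    proof (cases "j = 0")
      case True
      then show ?thesis
        using ij A row[OF ij(1)] by (simp add: P_def scalar_prod_def atLeast0LessThan)
    next
      case False
      have "(A * P) $$ (i, j) = (\<Sum>l<?m. A $$ (i, l) * P $$ (l, j))"
        using ij A carr(1) by (simp add: scalar_prod_def atLeast0LessThan del: sum.lessThan_Suc)
      also have "\<dots> = (\<Sum>l<?m. if l = j then A $$ (i, j) else 0)"
        by (intro sum.cong refl) (use ij False in \<open>auto simp: P_def\<close>)
      finally show ?thesis
        using False ij(2)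
        by (simp del: sum.lessThan_Suc)
    qed
    moreover have "(P * M) $$ (i, j) = (if j = 0 then d else A $$ (i, j))"
      unfolding P_mult[OF carr(3) ij] using ij by (auto simp: M_def B_def)
    ultimately show "(A * P) $$ (i, j) = (P * M) $$ (i, j)"
      by simp
  qed (use carr A in auto)
  have "A = A * (P * Q)"
    using A by (simp add: PQ)
  also have "\<dots> = P * M * Q"
    using assoc_mult_mat[OF A carr(1,2)] AP by simp
  finally have "similar_mat A M"
    using A carr PQ QP by (intro similar_matI[of A M P Q ?m]) auto
  then have "char_poly A = char_poly M"
    by (rule char_poly_similar)
  also have "\<dots> = char_poly (mat 1 1 (\<lambda>_. d)) * char_poly B"
    unfolding M_def by (rule char_poly_four_block_zeros_col) (auto simp: B_def)
  also have "char_poly (mat 1 1 (\<lambda>_. d)) = [:- d, 1:]"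
    by (simp add: char_poly_defs det_def sign_def)
  finally show ?thesis .
qed

text \<open>An eigenvector of the quotient matrix is read as a function \<open>f\<close> normalized
  to 0 at index 0. The quotient matrix gives \<open>A f\<close> minus its value at index 0, and that
  value becomes \<open>c\<close>.\<close>

lemma quotient_eigenvector:
  fixes A :: "real mat"
  assumes A: "A \<in> carrier_mat (Suc k) (Suc k)"
    and root: "poly (char_poly (mat k k (\<lambda>(i, j). A $$ (Suc i, Suc j) - A $$ (0, Suc j)))) \<mu> = 0"
  shows "\<exists>f c. (\<forall>i<Suc k. (\<Sum>j<Suc k. A $$ (i, j) * f j) = \<mu> * f i + c) \<and> (\<exists>i<Suc k. f i \<noteq> f 0)"
proof -
  define B where "B = mat k k (\<lambda>(i, j). A $$ (Suc i, Suc j) - A $$ (0, Suc j))"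
  have B: "B \<in> carrier_mat k k"
    by (simp add: B_def)
  have "eigenvalue B \<mu>"
    using root eigenvalue_root_char_poly[OF B] by (simp add: B_def)
  then obtain u where u: "u \<in> carrier_vec k" "u \<noteq> 0\<^sub>v k" "B *\<^sub>v u = \<mu> \<cdot>\<^sub>v u"
    using B by (auto simp: eigenvalue_def eigenvector_def)
  define f where "f i = (case i of 0 \<Rightarrow> 0 | Suc i \<Rightarrow> u $ i)" for i
  define c where "c = (\<Sum>j<k. A $$ (0, Suc j) * u $ j)"
  have "\<exists>i<k. u $ i \<noteq> 0"
    using u(1,2) by (metis carrier_vecD eq_vecI index_zero_vec)
  then obtain i where i: "i < k" "u $ i \<noteq> 0"
    by blast
  have "\<forall>i<Suc k. (\<Sum>j<Suc k. A $$ (i, j) * f j) = \<mu> * f i + c"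
  proof (intro allI impI)
    fix i assume i: "i < Suc k"
    show "(\<Sum>j<Suc k. A $$ (i, j) * f j) = \<mu> * f i + c"
    proof (cases i)
      case 0
      then show ?thesis
        by (simp add: f_def c_def sum.lessThan_Suc_shift del: sum.lessThan_Suc)
    next
      case (Suc i')
      then have "(B *\<^sub>v u) $ i' = \<mu> * u $ i'"
        using u i by simp
      then have "(\<Sum>j<k. (A $$ (i, Suc j) - A $$ (0, Suc j)) * u $ j) = \<mu> * u $ i'"
        using u Suc i by (simp add: B_def scalar_prod_def atLeast0LessThan)
      then show ?thesis
        by (simp add: Suc f_def c_def sum.lessThan_Suc_shift algebra_simps sum_subtractf
            del: sum.lessThan_Suc)
    qed
  qed
  moreover have "Suc i < Suc k" "f (Suc i) \<noteq> f 0"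
    using i by (simp_all add: f_def)
  ultimately show ?thesis
    by blast
qed

text \<open>Since \<open>d\<close> is a root and no root of \<open>p\<close> exceeds it, it is the
  largest entry. Cancelling one linear factor respects multiplicities, so
  \<open>\<theta> (n - 1)\<close> is a root of \<open>p\<close> even if \<open>d\<close> occurs
  again.\<close>

lemma sorted_roots_top:
  fixes \<theta> :: "nat \<Rightarrow> real"
  assumes prod: "(\<Prod>i = 1..n. [:- \<theta> i, 1:]) = [:- d, 1:] * p"
    and sorted: "\<forall>i \<in> {1..<n}. \<theta> i \<le> \<theta> (i + 1)"
    and roots: "\<And>r. poly p r = 0 \<Longrightarrow> r \<le> d"
    and n: "n \<ge> 2"
  shows "\<theta> n = d" and "poly p (\<theta> (n - 1)) = 0"
proof -
  have le: "\<theta> i \<le> \<theta> n" if "1 \<le> i" "i \<le> n" for i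
    using that(2,1) by (induction rule: inc_induct) (use sorted in force)+
  have root_iff: "(\<exists>i\<in>{1..n}. \<theta> i = r) \<longleftrightarrow> r = d \<or> poly p r = 0" for r
  proof -
    have "poly (\<Prod>i = 1..n. [:- \<theta> i, 1:]) r = 0 \<longleftrightarrow> (\<exists>i\<in>{1..n}. \<theta> i = r)"
      by (auto simp: poly_prod)
    then show ?thesis
      unfolding prod by auto
  qed
  have "\<theta> n \<le> d"
    using root_iff[of "\<theta> n"] roots n by fastforce
  moreover have "d \<le> \<theta> n"
    using root_iff[of d] le by auto
  ultimately show top: "\<theta> n = d"
    by simp
  obtain m where m: "n = Suc m"
    using n by (cases n) auto
  have "[:- d, 1:] * (\<Prod>i = 1..m. [:- \<theta> i, 1:]) = [:- d, 1:] * p"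
    using prod top by (simp add: m atLeastAtMostSuc_conv mult.commute)
  then have "(\<Prod>i = 1..m. [:- \<theta> i, 1:]) = p"
    by (simp only: mult_cancel_left) simp
  moreover have "poly (\<Prod>i = 1..m. [:- \<theta> i, 1:]) (\<theta> m) = 0"
    using n m by (auto simp: poly_prod intro!: bexI[of _ m])
  ultimately show "poly p (\<theta> (n - 1)) = 0"
    by (simp add: m)
qed

section \<open>Passage from the digraph model to the adjacency relation\<close>

lemma (in wf_digraph) distance_eq_two:
  assumes "u \<rightarrow> w" "w \<rightarrow> v" "u \<noteq> v" "\<not> u \<rightarrow> v"
  shows "\<mu> (\<lambda>_. 1) u v = 2"
proof (rule antisym)
  obtain e f where ef: "e \<in> arcs G" "tail G e = u" "head G e = w" "f \<in> arcs G" "tail G f = w" "head G f = v"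
    using assms(1,2) by (auto simp: arcs_ends_conv)
  then have "awalk u [e, f] v"
    by (auto simp: awalk_Cons_iff awalk_Nil_iff)
  from min_cost_le_walk_cost[OF this, of "\<lambda>_. 1"] show "\<mu> (\<lambda>_. 1) u v \<le> 2"
    by simp
next
  show "2 \<le> \<mu> (\<lambda>_. 1) u v"
    unfolding \<mu>_def
  proof (rule INF_greatest)
    fix p assume "p \<in> {p. awalk u p v}"
    then have p: "awalk u p v"
      by simp
    have "length p \<noteq> 0"
      using p assms(3) by (auto simp: awalk_Nil_iff)
    moreover have "length p \<noteq> 1"
      using p assms(4) by (auto simp: length_Suc_conv awalk_Cons_iff awalk_Nil_iff in_arcs_imp_in_arcs_ends)
    ultimately have "length p \<ge> 2"
      by linarith
    moreover have "awalk_cost (\<lambda>_. 1) p = length p"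
      by (simp add: awalk_cost_def sum_list_triv)
    ultimately show "2 \<le> ereal (awalk_cost (\<lambda>_. 1) p)"
      by simp
  qed
qed

lemma (in amply_regular_graph) relation: "amply_regular_relation (verts G) (\<lambda>u v. u \<rightarrow> v) d \<alpha> \<beta>"
proof
  show "finite (verts G)"
    by simp
  show "v \<in> verts G" if "u \<rightarrow> v" for u v
    using that by (simp add: adj_in_verts)
  show sym: "v \<rightarrow> u" if "u \<rightarrow> v" for u v
    using that by (rule graph_symmetric)
  show "\<not> u \<rightarrow> u" for u
    using no_loops by (auto simp: arcs_ends_conv)
  have common: "common_neighbors G u v = {w. u \<rightarrow> w \<and> v \<rightarrow> w}" for u v
    by (auto simp: common_neighbors_def adj_in_verts)
  show "card {v. u \<rightarrow> v} = d" if "u \<in> verts G" for u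
  proof -
    have "{v. u \<rightarrow> v} = head G ` out_arcs G u"
      by (auto simp: arcs_ends_conv)
    \<comment> \<open>The out-degree counts arcs; without parallel arcs it counts
      neighbours.\<close>
    moreover have "inj_on (head G) (out_arcs G u)"
      by (auto simp: inj_on_def arc_to_ends_def intro: no_multi_arcs)
    ultimately show ?thesis
      using regular[OF that] by (simp add: card_image out_degree_def)
  qed
  show "card {w. u \<rightarrow> w \<and> v \<rightarrow> w} = \<alpha>" if "u \<rightarrow> v" for u v
    using adjacent[of u v] that by (simp add: common adj_in_verts)
  show "card {w. u \<rightarrow> w \<and> v \<rightarrow> w} = \<beta>" if "u \<noteq> v" "\<not> u \<rightarrow> v" "u \<rightarrow> w" "v \<rightarrow> w" for u v w
    using distance_two[of u v] distance_eq_two[of u w v] that sym by (simp add: common adj_in_verts)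
qed

text \<open>Connectedness is used only in this form: once for a level set of an eigenfunction, once
  for a closed neighbourhood.\<close>

lemma (in wf_digraph) separating_arc:
  assumes "symmetric G" "Digraph_Component.connected G" "u \<in> verts G" "v \<in> verts G" "P u" "\<not> P v"
  shows "\<exists>a b. a \<rightarrow> b \<and> P a \<and> \<not> P b"
proof -
  have "u \<rightarrow>\<^sup>* v"
    using symmetric_connected_imp_strongly_connected[OF assms(1,2)] assms(3,4)
    by (simp add: strongly_connected_def)
  then have "P v \<or> (\<exists>a b. a \<rightarrow> b \<and> P a \<and> \<not> P b)"
    by (induction rule: reachable_induct) (use assms(5) in blast)+
  with assms(6) show ?thesis
    by blast
qed

theorem theorem1p6:
  fixes G :: "('a, 'b) pre_digraph"
    and n d \<alpha> \<beta> :: nat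
    and vs :: "'a list"
    and \<theta> :: "nat \<Rightarrow> real"
  assumes "amply_regular_graph G n d \<alpha> \<beta>"
    and "Digraph_Component.connected G"
    and "\<not> complete_digraph n G"
    and "arcs G \<noteq> {}"
    and "distinct vs" and "set vs = verts G"
    and "char_poly (adjacency_matrix G vs) = (\<Prod>i = 1..n. [:- \<theta> i, 1:])"
    and "\<forall>i \<in> {1..<n}. \<theta> i \<le> \<theta> (i + 1)"
  shows "\<theta> n = real d \<and>
    (\<beta> \<noteq> 1 \<and> \<beta> \<ge> \<alpha> \<and> (\<alpha>, \<beta>) \<noteq> (2, 2) \<longrightarrow>
      \<theta> (n - 1) \<le> real d - 2 -
        max (real \<alpha> / 2)
          (real_of_int \<lceil>(real \<beta> - real \<alpha>) * real \<alpha> / (real \<beta> - 1)\<rceil>)) \<and>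
    (\<alpha> = 2 \<and> \<beta> = 2 \<longrightarrow> \<theta> (n - 1) \<le> real d - 2)"
proof -
  interpret amply_regular_graph G n d \<alpha> \<beta>
    by (rule assms(1))
  interpret R: amply_regular_relation "verts G" "\<lambda>u v. u \<rightarrow>\<^bsub>G\<^esub> v" d \<alpha> \<beta>
    by (rule relation)
  define A where "A = adjacency_matrix G vs"
  have len: "length vs = n"
    using distinct_card[OF assms(5)] assms(6) card_verts by simp
  obtain e where e: "e \<in> arcs G"
    using assms(4) by blast
  \<comment> \<open>Without loops an arc has two distinct ends, so \<open>n - 1\<close> is a valid
    index of an eigenvalue.\<close>
  have "card {tail G e, head G e} \<le> n"
    unfolding card_verts[symmetric] using e by (intro card_mono) auto
  then have n: "n \<ge> 2"
    using no_loops[OF e] by simp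
  then obtain k where k: "n = Suc k"
    by (cases n) auto
  have A: "A \<in> carrier_mat (Suc k) (Suc k)"
    by (simp add: A_def adjacency_matrix_def len k)
  have bij: "bij_betw ((!) vs) {..<Suc k} (verts G)"
    using bij_betw_nth[OF assms(5)] assms(6) len k by simp
  have A_sum: "(\<Sum>j<Suc k. A $$ (i, j) * F (vs ! j)) = (\<Sum>w\<in>R.N (vs ! i). F w)" if "i < Suc k" for i F
  proof -
    have "(\<Sum>j<Suc k. A $$ (i, j) * F (vs ! j)) =
        (\<Sum>j<Suc k. if vs ! i \<rightarrow>\<^bsub>G\<^esub> vs ! j then F (vs ! j) else 0)"
      using that by (intro sum.cong) (auto simp: A_def adjacency_matrix_def len k)
    also have "\<dots> = (\<Sum>w\<in>verts G. if vs ! i \<rightarrow>\<^bsub>G\<^esub> w then F w else 0)"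
      by (rule sum.reindex_bij_betw[OF bij])
    finally show ?thesis
      by (simp add: R.sum_N_eq)
  qed
  have nth_in: "vs ! i \<in> verts G" if "i < Suc k" for i
    using that bij by (auto simp: bij_betw_def)
  define p where "p = char_poly (mat k k (\<lambda>(i, j). A $$ (Suc i, Suc j) - A $$ (0, Suc j)))"
  have row: "(\<Sum>j<Suc k. A $$ (i, j)) = real d" if "i < Suc k" for i
    using A_sum[OF that, of "\<lambda>_. 1"] R.card_N[OF nth_in[OF that]] by simp
  have cp: "(\<Prod>i = 1..n. [:- \<theta> i, 1:]) = [:- real d, 1:] * p"
  proof -
    have "char_poly A = [:- real d, 1:] * p"
      unfolding p_def by (rule char_poly_constant_row_sum[OF A row])
    then show ?thesis
      using assms(7) by (simp only: A_def)
  qed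
  \<comment> \<open>Roots of \<open>p\<close>, unlike those of the full characteristic polynomial,
    always come with a nonconstant function, even if they equal \<open>d\<close>.\<close>
  have eigenfunction: "\<exists>F c u v. (\<forall>w\<in>verts G. (\<Sum>x\<in>R.N w. F x) = \<mu> * F w + c) \<and>
      u \<rightarrow>\<^bsub>G\<^esub> v \<and> F u \<noteq> F v" if "poly p \<mu> = 0" for \<mu> :: real
  proof -
    obtain f c i where f: "\<forall>i<Suc k. (\<Sum>j<Suc k. A $$ (i, j) * f j) = \<mu> * f i + c"
      and i: "i < Suc k" "f i \<noteq> f 0"
      using quotient_eigenvector[OF A \<open>poly p \<mu> = 0\<close>[unfolded p_def]] by blast
    define F where "F v = f (the_inv_into {..<Suc k} ((!) vs) v)" for v
    have F: "F (vs ! j) = f j" if "j < Suc k" for j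
      using that bij by (simp add: F_def the_inv_into_f_f bij_betw_def)
    have "\<forall>w\<in>verts G. (\<Sum>x\<in>R.N w. F x) = \<mu> * F w + c"
    proof
      fix w assume "w \<in> verts G"
      then obtain j where j: "j < Suc k" "w = vs ! j"
        using bij by (auto simp: bij_betw_def)
      have "(\<Sum>x\<in>R.N w. F x) = (\<Sum>l<Suc k. A $$ (j, l) * F (vs ! l))"
        unfolding j(2) by (rule A_sum[OF j(1), symmetric])
      also have "\<dots> = (\<Sum>l<Suc k. A $$ (j, l) * f l)"
        by (intro sum.cong) (auto simp: F)
      finally show "(\<Sum>x\<in>R.N w. F x) = \<mu> * F w + c"
        unfolding j(2) F[OF j(1)] using f j(1) by (metis (no_types))
    qed
    moreover have "F (vs ! i) \<noteq> F (vs ! 0)"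
      using F[of 0] F[OF i(1)] i(2) by simp
    \<comment> \<open>This arc leaves the level set of \<open>F\<close> through
      \<open>vs ! 0\<close>.\<close>
    then have "\<exists>a b. a \<rightarrow>\<^bsub>G\<^esub> b \<and> F a = F (vs ! 0) \<and> F b \<noteq> F (vs ! 0)"
      by (intro separating_arc[OF sym_arcs assms(2) nth_in nth_in[OF i(1)]]) simp_all
    then have "\<exists>a b. a \<rightarrow>\<^bsub>G\<^esub> b \<and> F a \<noteq> F b"
      by metis
    ultimately show ?thesis
      by blast
  qed
  have roots: "\<mu> \<le> real d" if "poly p \<mu> = 0" for \<mu>
  proof -
    obtain F c u v where "\<forall>w\<in>verts G. (\<Sum>x\<in>R.N w. F x) = \<mu> * F w + c" "u \<rightarrow>\<^bsub>G\<^esub> v" "F u \<noteq> F v"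
      using eigenfunction[OF \<open>poly p \<mu> = 0\<close>] by blast
    then show ?thesis
      using R.eigenvalue_le_degree[of F \<mu> c u v] by (auto simp: adj_in_verts)
  qed
  have top: "\<theta> n = real d" and "poly p (\<theta> (n - 1)) = 0"
    using sorted_roots_top[OF cp assms(8) roots n] by blast+
  then obtain F c u v where eigen: "\<And>w. w \<in> verts G \<Longrightarrow> (\<Sum>x\<in>R.N w. F x) = \<theta> (n - 1) * F w + c"
    and nonconst: "u \<rightarrow>\<^bsub>G\<^esub> v" "F u \<noteq> F v"
    using eigenfunction by blast
  have "\<exists>x y. x \<in> verts G \<and> y \<in> verts G \<and> x \<noteq> y \<and> \<not> x \<rightarrow>\<^bsub>G\<^esub> y"
  proof (rule ccontr)
    assume "\<not> ?thesis"
    then have "arcs_ends G = {(x, y). (x, y) \<in> verts G \<times> verts G \<and> x \<noteq> y}"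
      using R.E_irrefl by (auto simp: adj_in_verts)
    then have "complete_digraph n G"
      using card_verts graph_axioms by (simp add: complete_digraph_def)
    with assms(3) show False ..
  qed
  then obtain x y where xy: "x \<in> verts G" "y \<in> verts G" "x \<noteq> y" "\<not> x \<rightarrow>\<^bsub>G\<^esub> y"
    by blast
  \<comment> \<open>An arc leaving the closed neighbourhood of \<open>x\<close> yields an induced
    path \<open>x\<close>, \<open>a\<close>, \<open>b\<close>.\<close>
  obtain a b where ab: "a \<rightarrow>\<^bsub>G\<^esub> b" "a = x \<or> x \<rightarrow>\<^bsub>G\<^esub> a" "\<not> (b = x \<or> x \<rightarrow>\<^bsub>G\<^esub> b)"
    using separating_arc[OF sym_arcs assms(2) xy(1,2), of "\<lambda>w. w = x \<or> x \<rightarrow>\<^bsub>G\<^esub> w"] xy(3,4) by blast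
  then have path: "x \<rightarrow>\<^bsub>G\<^esub> a" "a \<rightarrow>\<^bsub>G\<^esub> b" "x \<noteq> b" "\<not> x \<rightarrow>\<^bsub>G\<^esub> b"
    by auto
  have \<beta>: "\<beta> > 0"
    by (rule R.beta_pos[OF path])
  have "\<theta> (n - 1) \<le> real d - 2 - max (real \<alpha> / 2)
      (real_of_int \<lceil>(real \<beta> - real \<alpha>) * real \<alpha> / (real \<beta> - 1)\<rceil>)"
    if "\<beta> \<noteq> 1" "\<beta> \<ge> \<alpha>" "(\<alpha>, \<beta>) \<noteq> (2, 2)"
    using R.nontrivial_eigenvalue_bound[OF path _ that(2,3) eigen nonconst] that(1) \<beta> by simp
  \<comment> \<open>Here the ceiling term is 0, and the transport bound alone gives the
    claim.\<close>
  moreover have "\<theta> (n - 1) \<le> real d - 2" if "\<alpha> = 2" "\<beta> = 2"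
    using R.eigenvalue_curvature_bound[OF _ _ eigen nonconst] that by simp
  ultimately show ?thesis
    using top by blast
qed

end
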